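(* Let $n\ge0$ be an integer with $\chi_n>c^2$, and let $x\in(1,\infty)$ be a root of $\psi_n$. Then $$\frac{1}{|\psi_n'(x)|}\le e^{1/4}|\lambda_n|\frac{(x^2-1)^{3/4}}{(x^2-\chi_n/c^2)^{1/4}}.$$
   Context: For a real number $c>0$, let $F_c[\varphi](x)=\int_{-1}^1\varphi(t)e^{icxt}\,dt$ on $L^2[-1,1]$, with eigenvalues $\lambda_0,\lambda_1,\dots$ ordered so that $|\lambda_n|\ge|\lambda_{n+1}|$ (nonzero, simple) and corresponding real eigenfunctions $\psi_0,\psi_1,\dots$ (prolate spheroidal wave functions) with $\|\psi_n\|_{L^2[-1,1]}=1$. Each $\psi_n$ is extended to an entire function by $\lambda_n\psi_n(x)=\int_{-1}^1\psi_n(t)e^{icxt}\,dt$ for all complex $x$. $\chi_0<\chi_1<\dots$ are the positive numbers such that $\psi_n$ satisfies $(1-x^2)\psi''(x)-2x\psi'(x)+(\chi_n-c^2x^2)\psi(x)=0$ (which then holds for all complex $x$). *)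

theory Defs
  imports "HOL-Analysis.Analysis"
begin

definition Fc :: "real \<Rightarrow> (real \<Rightarrow> complex) \<Rightarrow> real \<Rightarrow> complex" where
  "Fc c \<phi> x = integral {-1..1} (\<lambda>t. \<phi> t * exp (\<i> * complex_of_real (c * x * t)))"

definition Fc_eigenpair :: "real \<Rightarrow> complex \<Rightarrow> (real \<Rightarrow> complex) \<Rightarrow> bool" where
  "Fc_eigenpair c \<mu> \<phi> \<longleftrightarrow>
     \<phi> measurable_on {-1..1} \<and>
     (\<lambda>t. (norm (\<phi> t))\<^sup>2) integrable_on {-1..1} \<and>
     \<not> negligible {t \<in> {-1..1}. \<phi> t \<noteq> 0} \<and>
     (\<exists>N. negligible N \<and> (\<forall>x \<in> {-1..1} - N. Fc c \<phi> x = \<mu> * \<phi> x))"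

text \<open>The system of prolate spheroidal wave functions for bandlimit c:
  lam n are all eigenvalues of F_c (nonzero, simple, ordered by non-increasing modulus),
  psi n the real, L^2-normalised eigenfunctions, extended to the real line by
  lam n * psi n x = int_{-1}^1 psi n t e^{icxt} dt, and chi n the positive, strictly
  increasing numbers for which psi n solves the prolate ODE.\<close>
definition pswf_system ::
  "real \<Rightarrow> (nat \<Rightarrow> complex) \<Rightarrow> (nat \<Rightarrow> real \<Rightarrow> real) \<Rightarrow> (nat \<Rightarrow> real) \<Rightarrow> bool" where
  "pswf_system c lam psi chi \<longleftrightarrow>
     c > 0 \<and>
     (\<forall>n. lam n \<noteq> 0) \<and>
     inj lam \<and>
     (\<forall>n. norm (lam (Suc n)) \<le> norm (lam n)) \<and>
     (\<forall>n x. ((\<lambda>t. complex_of_real (psi n t) * exp (\<i> * complex_of_real (c * x * t)))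
                has_integral (lam n * complex_of_real (psi n x))) {-1..1}) \<and>
     (\<forall>n. ((\<lambda>t. (psi n t)\<^sup>2) has_integral 1) {-1..1}) \<and>
     (\<forall>\<mu> \<phi>. Fc_eigenpair c \<mu> \<phi> \<longrightarrow>
        (\<exists>k. \<mu> = lam k \<and>
           (\<exists>a::complex. \<exists>N. negligible N \<and>
              (\<forall>t \<in> {-1..1} - N. \<phi> t = a * complex_of_real (psi k t))))) \<and>
     (\<forall>n. chi n > 0) \<and>
     strict_mono chi \<and>
     (\<forall>n x. (1 - x\<^sup>2) * deriv (deriv (psi n)) x - 2 * x * deriv (psi n) x
              + (chi n - c\<^sup>2 * x\<^sup>2) * psi n x = 0)"

end

theory Submission
  imports Defs
begin

text \<open>
  Put \<open>A = \<chi> / c\<^sup>2\<close>. The Liouville transformation \<open>d\<tau> = sqrt ((x\<^sup>2 - A) / (x\<^sup>2 - 1)) dx\<close>,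
  \<open>y = h \<psi>\<close> with \<open>h = ((x\<^sup>2 - 1) (x\<^sup>2 - A)) powr (1/4)\<close> turns the prolate equation on
  \<open>x\<^sup>2 > A\<close> into \<open>y'' + (c\<^sup>2 + G) y = 0\<close>, where \<open>G = - h'' / h\<close> turns out to be positive and decreasing.
  Hence the energy \<open>y'\<^sup>2 + (c\<^sup>2 + G) y\<^sup>2\<close> decreases. At a root of \<open>\<psi>\<close> it equals
  \<open>\<psi>'\<^sup>2 (x\<^sup>2 - 1) powr (3/2) / (x\<^sup>2 - A) powr (1/2)\<close>, and integrating by parts in the integral
  equation shows that at infinity it is at least \<open>4 (\<psi> 1)\<^sup>2 / \<bar>\<lambda>\<bar>\<^sup>2\<close>. Since \<open>\<chi> > c\<^sup>2\<close>, the
  function \<open>\<psi>\<^sup>2\<close> is maximal on \<open>[-1, 1]\<close> at the end points, so \<open>(\<psi> 1)\<^sup>2 \<ge> 1/2\<close>; moreover \<open>\<psi>\<^sup>2\<close>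
  is nondecreasing on \<open>[1, sqrt A]\<close>, so every root beyond 1 lies in the region \<open>x\<^sup>2 > A\<close>.
\<close>

subsection \<open>Monotonicity along solutions of the prolate equation\<close>

locale prolate_solution =
  fixes c chi :: real and f f' f'' :: "real \<Rightarrow> real"
  assumes c_pos: "c > 0" and chi_gt: "chi > c\<^sup>2"
    and f_deriv: "\<And>x. (f has_real_derivative f' x) (at x)"
    and f'_deriv: "\<And>x. (f' has_real_derivative f'' x) (at x)"
    and ode: "\<And>x. (1 - x\<^sup>2) * f'' x - 2 * x * f' x + (chi - c\<^sup>2 * x\<^sup>2) * f x = 0"
begin

text \<open>With p = 1 - x^2 and q = chi - c^2 x^2 the equation reads (p f')' + q f = 0, and the
  Sonin function Q = f^2 + p f'^2 / q has derivative -(p q)' (f' / q)^2. On [0, 1] both p and q are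
  nonnegative and nonincreasing, so Q is nondecreasing; it dominates f^2 and agrees with f^2 at
  1.\<close>

lemma square_le_value_at_one:
  assumes "0 \<le> t" "t \<le> 1"
  shows "(f t)\<^sup>2 \<le> (f 1)\<^sup>2"
proof -
  have q_pos: "chi - c\<^sup>2 * x\<^sup>2 > 0" if "0 \<le> x" "x \<le> 1" for x
  proof -
    have "c\<^sup>2 * x\<^sup>2 \<le> c\<^sup>2"
      using that by (simp add: mult_left_le power_le_one)
    then show ?thesis using chi_gt by simp
  qed
  define Q where "Q = (\<lambda>x. (f x)\<^sup>2 + (1 - x\<^sup>2) * (f' x)\<^sup>2 / (chi - c\<^sup>2 * x\<^sup>2))"
  define Q' where "Q' = (\<lambda>x. (2 * x * (chi - c\<^sup>2 * x\<^sup>2) + 2 * c\<^sup>2 * x * (1 - x\<^sup>2))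
      * (f' x)\<^sup>2 / (chi - c\<^sup>2 * x\<^sup>2)\<^sup>2)"
  have "(Q has_real_derivative Q' x) (at x) \<and> Q' x \<ge> 0" if "t \<le> x" "x \<le> 1" for x
  proof -
    have q: "chi - c\<^sup>2 * x\<^sup>2 > 0" using q_pos[of x] that assms by auto
    have "x\<^sup>2 \<le> 1" using that assms by (simp add: power_le_one)
    then have nonneg: "Q' x \<ge> 0"
      using q that assms unfolding Q'_def by (intro divide_nonneg_pos mult_nonneg_nonneg add_nonneg_nonneg) auto
    define q where "q = chi - c\<^sup>2 * x\<^sup>2"
    define w where "w = 2 * x * f' x - q * f x"
    have "q > 0" using q by (simp add: q_def)
    \<comment> \<open>The equation replaces the product \<open>(1 - x\<^sup>2) * f'' x\<close> as a
      whole. Nothing is divided by \<open>1 - x\<^sup>2\<close>, so the end point 1 is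
      covered.\<close>
    have w: "(1 - x\<^sup>2) * f'' x = w" using ode[of x] by (simp add: w_def q_def)
    have e: "(1 - x\<^sup>2) * (2 * f' x * f'' x) = 2 * f' x * w" by (simp add: w[symmetric] mult_ac)
    have "((\<lambda>x. (1 - x\<^sup>2) * (f' x)\<^sup>2) has_real_derivative
        - 2 * x * (f' x)\<^sup>2 + (1 - x\<^sup>2) * (2 * f' x * f'' x)) (at x)"
      by (auto intro!: derivative_eq_intros f'_deriv)
    moreover have "((\<lambda>x. chi - c\<^sup>2 * x\<^sup>2) has_real_derivative - (c\<^sup>2 * (2 * x))) (at x)"
      by (auto intro!: derivative_eq_intros)
    ultimately have "((\<lambda>x. (1 - x\<^sup>2) * (f' x)\<^sup>2 / (chi - c\<^sup>2 * x\<^sup>2)) has_real_derivative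
        ((- 2 * x * (f' x)\<^sup>2 + 2 * f' x * w) * q - (1 - x\<^sup>2) * (f' x)\<^sup>2 * (- (c\<^sup>2 * (2 * x)))) / (q * q)) (at x)"
      unfolding e q_def using q by (intro DERIV_divide) auto
    moreover have "((\<lambda>x. (f x)\<^sup>2) has_real_derivative 2 * f x * f' x) (at x)"
      by (auto intro!: derivative_eq_intros f_deriv)
    ultimately have "(Q has_real_derivative 2 * f x * f' x +
        ((- 2 * x * (f' x)\<^sup>2 + 2 * f' x * w) * q - (1 - x\<^sup>2) * (f' x)\<^sup>2 * (- (c\<^sup>2 * (2 * x)))) / (q * q)) (at x)"
      unfolding Q_def by (intro DERIV_add)
    moreover have "2 * f x * f' x +
        ((- 2 * x * (f' x)\<^sup>2 + 2 * f' x * w) * q - (1 - x\<^sup>2) * (f' x)\<^sup>2 * (- (c\<^sup>2 * (2 * x)))) / (q * q) = Q' x"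
      unfolding Q'_def q_def[symmetric] w_def using \<open>q > 0\<close>
      by (simp add: add_divide_eq_iff power2_eq_square algebra_simps)
    ultimately show ?thesis using nonneg by simp
  qed
  then have "Q t \<le> Q 1"
    using DERIV_nonneg_imp_nondecreasing[of t 1 Q] assms by blast
  moreover have "(f t)\<^sup>2 \<le> Q t"
    using q_pos[of t] assms unfolding Q_def by (simp add: power_le_one)
  ultimately show ?thesis by (simp add: Q_def)
qed

text \<open>Since ((x^2 - 1) f')' = (chi - c^2 x^2) f, the function z = (x^2 - 1) f' f has a
  derivative that is a sum of two nonnegative terms before the turning point. As z vanishes at 1, f
  f' is nonnegative from there on.\<close>

lemma value_at_one_le_square:
  assumes "1 \<le> x" "c\<^sup>2 * x\<^sup>2 \<le> chi"
  shows "(f 1)\<^sup>2 \<le> (f x)\<^sup>2"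
proof -
  have le: "c\<^sup>2 * y\<^sup>2 \<le> chi" if "1 \<le> y" "y \<le> x" for y
  proof -
    have "c\<^sup>2 * y\<^sup>2 \<le> c\<^sup>2 * x\<^sup>2" using that by (intro mult_left_mono power_mono) auto
    then show ?thesis using assms by linarith
  qed
  define z where "z = (\<lambda>x. (x\<^sup>2 - 1) * f' x * f x)"
  have z_nonneg: "z y \<ge> 0" if "1 \<le> y" "y \<le> x" for y
  proof -
    have "z 1 \<le> z y"
    proof (rule DERIV_nonneg_imp_nondecreasing[of 1 y z])
      fix w assume w: "1 \<le> w" "w \<le> y"
      have "(z has_real_derivative (2 * w * f' w + (w\<^sup>2 - 1) * f'' w) * f w + (w\<^sup>2 - 1) * f' w * f' w) (at w)"
        unfolding z_def by (auto intro!: derivative_eq_intros f_deriv f'_deriv simp: algebra_simps)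
      moreover have "2 * w * f' w + (w\<^sup>2 - 1) * f'' w = (chi - c\<^sup>2 * w\<^sup>2) * f w"
        using ode[of w] by (simp add: algebra_simps)
      ultimately have "(z has_real_derivative (chi - c\<^sup>2 * w\<^sup>2) * (f w)\<^sup>2 + (w\<^sup>2 - 1) * (f' w)\<^sup>2) (at w)"
        by (simp add: power2_eq_square mult.assoc)
      moreover have "(chi - c\<^sup>2 * w\<^sup>2) * (f w)\<^sup>2 + (w\<^sup>2 - 1) * (f' w)\<^sup>2 \<ge> 0"
        using le[of w] w that by (intro add_nonneg_nonneg mult_nonneg_nonneg) auto
      ultimately show "\<exists>k. (z has_real_derivative k) (at w) \<and> 0 \<le> k" by blast
    qed (use that in auto)
    then show ?thesis by (simp add: z_def)
  qed
  show ?thesis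
  proof (rule DERIV_nonneg_imp_nondecreasing[of 1 x "\<lambda>x. (f x)\<^sup>2"])
    fix y assume y: "1 \<le> y" "y \<le> x"
    have d: "((\<lambda>x. (f x)\<^sup>2) has_real_derivative 2 * f y * f' y) (at y)"
      by (auto intro!: derivative_eq_intros f_deriv)
    have "f y * f' y \<ge> 0"
    proof (cases "y = 1")
      case True
      \<comment> \<open>At 1 the weight in \<open>z\<close> vanishes, so \<open>z\<close> says
        nothing about \<open>f 1 * f' 1\<close>. The sign comes from the equation at its singular
        point, where the second-order term drops out.\<close>
      have "2 * f' 1 = (chi - c\<^sup>2) * f 1" using ode[of 1] by simp
      then have "2 * (f 1 * f' 1) = (chi - c\<^sup>2) * (f 1)\<^sup>2" by (simp add: power2_eq_square)
      moreover have "(chi - c\<^sup>2) * (f 1)\<^sup>2 \<ge> 0" using chi_gt by simp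
      ultimately have "f 1 * f' 1 \<ge> 0" by linarith
      then show ?thesis using True by simp
    next
      case False
      then have "y\<^sup>2 - 1 > 0" using y by simp
      moreover have "(y\<^sup>2 - 1) * (f y * f' y) \<ge> 0" using z_nonneg[OF y] by (simp add: z_def mult_ac)
      ultimately show ?thesis by (simp add: zero_le_mult_iff)
    qed
    with d show "\<exists>k. ((\<lambda>x. (f x)\<^sup>2) has_real_derivative k) (at y) \<and> 0 \<le> k" by fastforce
  qed (use assms in auto)
qed

lemma root_beyond_turning_point:
  assumes "1 < x" "f x = 0" "f 1 \<noteq> 0"
  shows "x\<^sup>2 > chi / c\<^sup>2"
proof (rule ccontr)
  assume "\<not> ?thesis"
  then have "c\<^sup>2 * x\<^sup>2 \<le> chi" using c_pos by (simp add: field_simps)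
  from value_at_one_le_square[OF _ this] assms show False by simp
qed

section \<open>Liouville form and energy beyond the turning point \<open>sqrt turn\<close>\<close>

definition turn :: real where "turn = chi / c\<^sup>2"

text \<open>\<open>liouville_pot\<close> is \<open>G = - h'' / h\<close> (derivatives in \<open>\<tau>\<close>), written in powers of
  \<open>x\<^sup>2 - turn\<close> so that all coefficients are visibly positive; \<open>amplitude_logder\<close> is the logarithmic
  \<open>x\<close>-derivative of \<open>h\<close>.\<close>

definition liouville_pot :: "real \<Rightarrow> real" where
  "liouville_pot x =
     ((6 * (turn - 1) + 4) * (x\<^sup>2 - turn)\<^sup>2 + (11 * (turn - 1)\<^sup>2 + 8 * (turn - 1)) * (x\<^sup>2 - turn)
       + 5 * (turn - 1) ^ 3 + 5 * (turn - 1)\<^sup>2) / (4 * (x\<^sup>2 - 1) * (x\<^sup>2 - turn) ^ 3)"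

definition amplitude_logder :: "real \<Rightarrow> real" where
  "amplitude_logder x = x * (1 / (x\<^sup>2 - 1) + 1 / (x\<^sup>2 - turn)) / 2"

text \<open>This is (dy/dtau)^2 + (c^2 + G) y^2 for y = h f, written in x: the square root in front
  is h^2, the quotient is (dx/dtau)^2, and \<open>amplitude_logder x * f x + f' x\<close> is (h f)'
  / h.\<close>

definition energy :: "real \<Rightarrow> real" where
  "energy x = sqrt ((x\<^sup>2 - 1) * (x\<^sup>2 - turn)) *
     ((x\<^sup>2 - 1) / (x\<^sup>2 - turn) * (amplitude_logder x * f x + f' x)\<^sup>2 + (c\<^sup>2 + liouville_pot x) * (f x)\<^sup>2)"

lemma turn_gt_one: "turn > 1"
  using c_pos chi_gt by (simp add: turn_def)

lemma liouville_pot_nonneg: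
  assumes "x\<^sup>2 > turn"
  shows "liouville_pot x \<ge> 0"
  unfolding liouville_pot_def using assms turn_gt_one
  by (intro divide_nonneg_nonneg add_nonneg_nonneg mult_nonneg_nonneg) auto

text \<open>In terms of V = x^2 - turn and d = turn - 1 > 0 the potential is N / (4 (V + d) V^3)
  with N quadratic in V and with positive coefficients. Hence V N' \<le> 2 N, so the numerator grows
  more slowly than V^3 in the denominator.\<close>

lemma liouville_pot_deriv:
  assumes "x > 0" "x\<^sup>2 > turn"
  shows "\<exists>D\<le>0. (liouville_pot has_real_derivative D) (at x)"
proof -
  define d where "d = turn - 1"
  have d: "d > 0" using turn_gt_one by (simp add: d_def)
  define V where "V = x\<^sup>2 - turn"
  have V: "V > 0" using assms by (simp add: V_def)
  define N where "N = (6 * d + 4) * V\<^sup>2 + (11 * d\<^sup>2 + 8 * d) * V + 5 * d ^ 3 + 5 * d\<^sup>2"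
  define N' where "N' = 2 * (6 * d + 4) * V + (11 * d\<^sup>2 + 8 * d)"
  have Vd: "x\<^sup>2 - 1 = V + d" by (simp add: V_def d_def)
  define D where "D = 2 * x * (N' * ((V + d) * V) - N * (V + 3 * (V + d))) / (4 * (V + d)\<^sup>2 * V ^ 4)"
  have num: "((\<lambda>x. (6 * d + 4) * (x\<^sup>2 - turn)\<^sup>2 + (11 * d\<^sup>2 + 8 * d) * (x\<^sup>2 - turn)
       + 5 * d ^ 3 + 5 * d\<^sup>2) has_real_derivative N' * (2 * x)) (at x)"
    unfolding N'_def V_def by (auto intro!: derivative_eq_intros simp: algebra_simps)
  have den: "((\<lambda>x. 4 * (x\<^sup>2 - 1) * (x\<^sup>2 - turn) ^ 3) has_real_derivative
       4 * (2 * x) * V ^ 3 + 4 * (V + d) * (3 * V\<^sup>2 * (2 * x))) (at x)"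
    unfolding Vd[symmetric] unfolding V_def by (auto intro!: derivative_eq_intros)
  have "((\<lambda>x. ((6 * d + 4) * (x\<^sup>2 - turn)\<^sup>2 + (11 * d\<^sup>2 + 8 * d) * (x\<^sup>2 - turn)
       + 5 * d ^ 3 + 5 * d\<^sup>2) / (4 * (x\<^sup>2 - 1) * (x\<^sup>2 - turn) ^ 3)) has_real_derivative
       ((N' * (2 * x)) * (4 * (V + d) * V ^ 3) - N * (4 * (2 * x) * V ^ 3 + 4 * (V + d) * (3 * V\<^sup>2 * (2 * x))))
         / (4 * (V + d) * V ^ 3)\<^sup>2) (at x)"
    using DERIV_divide[OF num den] V d
    unfolding Vd V_def[symmetric] N_def[symmetric] power2_eq_square[of "4 * (V + d) * V ^ 3"] by simp
  moreover have "((N' * (2 * x)) * (4 * (V + d) * V ^ 3) - N * (4 * (2 * x) * V ^ 3 + 4 * (V + d) * (3 * V\<^sup>2 * (2 * x))))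
         / (4 * (V + d) * V ^ 3)\<^sup>2 = D"
  proof -
    have "(N' * (2 * x)) * (4 * (V + d) * V ^ 3) - N * (4 * (2 * x) * V ^ 3 + 4 * (V + d) * (3 * V\<^sup>2 * (2 * x)))
      = (4 * V\<^sup>2) * (2 * x * (N' * ((V + d) * V) - N * (V + 3 * (V + d))))"
      by (simp add: algebra_simps power2_eq_square power3_eq_cube)
    moreover have "(4 * (V + d) * V ^ 3)\<^sup>2 = (4 * V\<^sup>2) * (4 * (V + d)\<^sup>2 * V ^ 4)"
      by (simp only: power_mult_distrib) (simp add: field_simps flip: power_mult power_add)
    ultimately show ?thesis using V unfolding D_def by simp
  qed
  moreover have "D \<le> 0"
  proof -
    have "N' * V \<le> 2 * N"
      using V d unfolding N_def N'_def by (simp add: algebra_simps power2_eq_square)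
    then have "N' * V * (V + d) \<le> 2 * N * (V + d)"
      using V d by (intro mult_right_mono) auto
    also have "\<dots> \<le> N * (V + 3 * (V + d))"
    proof -
      have "N \<ge> 0" using V d unfolding N_def by (intro add_nonneg_nonneg mult_nonneg_nonneg) auto
      then have "N * (2 * (V + d)) \<le> N * (V + 3 * (V + d))" using V d by (intro mult_left_mono) auto
      then show ?thesis by (simp add: mult_ac)
    qed
    finally have "N' * ((V + d) * V) - N * (V + 3 * (V + d)) \<le> 0" by (simp add: mult_ac)
    then show ?thesis unfolding D_def using assms V d
      by (intro divide_nonpos_nonneg mult_nonneg_nonpos) auto
  qed
  ultimately show ?thesis unfolding liouville_pot_def d_def by (intro exI[of _ D]) simp
qed

text \<open>From y'' + (c^2 + G) y = 0 the energy has derivative G' y^2, which is nonpositive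
  because G decreases. The computation is carried out in x, where \<open>2 * m\<close> is the
  logarithmic derivative of h^2 and \<open>r'\<close> is the derivative of (dx/dtau)^2.\<close>

lemma energy_deriv:
  assumes "x > 0" "x\<^sup>2 > turn"
  shows "\<exists>D\<le>0. (energy has_real_derivative D) (at x)"
proof -
  obtain G' where G': "G' \<le> 0" "(liouville_pot has_real_derivative G') (at x)"
    using liouville_pot_deriv[OF assms] by blast
  define P where "P = x\<^sup>2 - 1"
  define R where "R = x\<^sup>2 - turn"
  define G where "G = liouville_pot x"
  have R: "R > 0" using assms by (simp add: R_def)
  have P: "P > 0" using assms turn_gt_one by (simp add: P_def)
  define m where "m = amplitude_logder x"
  define m' where "m' = (1 / P + 1 / R) / 2 - x\<^sup>2 * (1 / P\<^sup>2 + 1 / R\<^sup>2)"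
  define r' where "r' = 2 * x / R - 2 * x * P / R\<^sup>2"
  have m: "m = x * (1 / P + 1 / R) / 2" by (simp add: m_def amplitude_logder_def P_def R_def)
  have dm: "(amplitude_logder has_real_derivative m') (at x)"
  proof -
    have "((\<lambda>x. x * (1 / (x\<^sup>2 - 1) + 1 / (x\<^sup>2 - turn)) / 2) has_real_derivative
        (1 * (1 / P + 1 / R) + x * (- (2 * x) / P\<^sup>2 + - (2 * x) / R\<^sup>2)) / 2) (at x)"
      using P R unfolding P_def R_def
      by (auto intro!: derivative_eq_intros simp: power2_eq_square)
    moreover have "(1 * (1 / P + 1 / R) + x * (- (2 * x) / P\<^sup>2 + - (2 * x) / R\<^sup>2)) / 2 = m'"
      using P R unfolding m'_def by (simp add: field_simps power2_eq_square)
    ultimately show ?thesis unfolding amplitude_logder_def by simp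
  qed
  have dr: "((\<lambda>x. (x\<^sup>2 - 1) / (x\<^sup>2 - turn)) has_real_derivative r') (at x)"
  proof -
    have "((\<lambda>x. (x\<^sup>2 - 1) / (x\<^sup>2 - turn)) has_real_derivative (2 * x * R - P * (2 * x)) / R\<^sup>2) (at x)"
      using R unfolding P_def R_def by (auto intro!: derivative_eq_intros simp: power2_eq_square)
    moreover have "(2 * x * R - P * (2 * x)) / R\<^sup>2 = r'"
      using R unfolding r'_def by (simp add: field_simps power2_eq_square)
    ultimately show ?thesis by simp
  qed
  have ds: "((\<lambda>x. sqrt ((x\<^sup>2 - 1) * (x\<^sup>2 - turn))) has_real_derivative sqrt (P * R) * (2 * m)) (at x)"
  proof -
    have PR: "P * R > 0" using P R by simp
    have "((\<lambda>x. sqrt ((x\<^sup>2 - 1) * (x\<^sup>2 - turn))) has_real_derivative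
        (2 * x * R + P * (2 * x)) * (inverse (sqrt (P * R)) / 2)) (at x)"
      using PR unfolding P_def R_def by (auto intro!: derivative_eq_intros)
    moreover have "(2 * x * R + P * (2 * x)) * (inverse (sqrt (P * R)) / 2) = sqrt (P * R) * (2 * m)"
    proof -
      have "inverse (sqrt (P * R)) = sqrt (P * R) / (P * R)"
      proof -
        define s where "s = sqrt (P * R)"
        have "s > 0" "P * R = s * s" using PR by (auto simp: s_def)
        then show ?thesis unfolding s_def[symmetric] by (simp add: divide_simps)
      qed
      then show ?thesis using P R unfolding m by (simp add: field_simps)
    qed
    ultimately show ?thesis by (simp only:)
  qed
  define u where "u = m * f x + f' x"
  define u' where "u' = m' * f x + m * f' x + f'' x"
  have du: "((\<lambda>x. amplitude_logder x * f x + f' x) has_real_derivative u') (at x)"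
    unfolding u'_def m_def by (auto intro!: derivative_eq_intros dm f_deriv f'_deriv)
  define B where "B = P / R * u\<^sup>2 + (c\<^sup>2 + G) * (f x)\<^sup>2"
  define B' where "B' = r' * u\<^sup>2 + P / R * (2 * u * u') + G' * (f x)\<^sup>2 + (c\<^sup>2 + G) * (2 * f x * f' x)"
  have "(energy has_real_derivative sqrt (P * R) * (2 * m) * B + sqrt (P * R) * B') (at x)"
  proof -
    have "((\<lambda>x. (amplitude_logder x * f x + f' x)\<^sup>2) has_real_derivative 2 * u * u') (at x)"
      using DERIV_power[OF du, of 2] by (simp add: u_def m_def mult_ac)
    moreover have "((\<lambda>x. (c\<^sup>2 + liouville_pot x) * (f x)\<^sup>2) has_real_derivative
        G' * (f x)\<^sup>2 + (c\<^sup>2 + G) * (2 * f x * f' x)) (at x)"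
      unfolding G_def by (auto intro!: derivative_eq_intros G' f_deriv)
    ultimately have "((\<lambda>x. (x\<^sup>2 - 1) / (x\<^sup>2 - turn) * (amplitude_logder x * f x + f' x)\<^sup>2
        + (c\<^sup>2 + liouville_pot x) * (f x)\<^sup>2) has_real_derivative
        (r' * (amplitude_logder x * f x + f' x)\<^sup>2 + 2 * u * u' * ((x\<^sup>2 - 1) / (x\<^sup>2 - turn)))
          + (G' * (f x)\<^sup>2 + (c\<^sup>2 + G) * (2 * f x * f' x))) (at x)"
      by (intro DERIV_add DERIV_mult dr)
    from DERIV_mult[OF ds this] show ?thesis
      unfolding energy_def B_def B'_def u_def m_def G_def P_def R_def by (simp add: mult_ac add_ac)
  qed
  moreover have "2 * m * B + B' = G' * (f x)\<^sup>2"
  proof -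
    have f'': "f'' x = - (2 * x / P) * f' x - (c\<^sup>2 * R / P) * f x"
    proof -
      have R_eq: "c\<^sup>2 * R = c\<^sup>2 * x\<^sup>2 - chi" using c_pos by (simp add: R_def turn_def algebra_simps)
      have "P * f'' x = - 2 * x * f' x - c\<^sup>2 * R * f x"
        unfolding R_eq using ode[of x] by (simp add: P_def algebra_simps)
      then show ?thesis using P by (simp add: field_simps)
    qed
    have c1: "2 * m * (P / R) + r' + 2 * (P / R) * m - 2 * (P / R) * (2 * x / P) = 0"
      using P R unfolding m r'_def by (simp add: field_simps power2_eq_square)
    \<comment> \<open>The right side is - h'' / h in tau, because d^2/dtau^2 = (P/R) d^2/dx^2 +
      (r'/2) d/dx and the logarithmic x-derivative of h is m.\<close>
    have Geq: "G = - (m * (P / R) + r' / 2) * m - P / R * m'"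
    proof -
      define d where "d = turn - 1"
      have Pd: "P = R + d" by (simp add: P_def R_def d_def)
      have xd: "x\<^sup>2 = R + d + 1" by (simp add: R_def d_def)
      have "G = ((6 * d + 4) * R\<^sup>2 + (11 * d\<^sup>2 + 8 * d) * R + 5 * d ^ 3 + 5 * d\<^sup>2) / (4 * P * R ^ 3)"
        by (simp add: G_def liouville_pot_def P_def R_def d_def)
      moreover have "- (m * (P / R) + r' / 2) * m - P / R * m'
        = (x\<^sup>2 * (5 * P\<^sup>2 - 2 * P * R + R\<^sup>2) - 2 * P * R * (P + R)) / (4 * P * R ^ 3)"
      proof -
        \<comment> \<open>Treating the reciprocals as unknowns with P p = 1 and R r = 1 turns the
          rational identity into polynomial ones.\<close>
        define p where "p = 1 / P"
        define r where "r = 1 / R"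
        have pr: "P * p = 1" "R * r = 1" using P R by (auto simp: p_def r_def)
        have "- (x * (p + r) / 2 * (P * r) + (2 * x * r - 2 * x * P * r\<^sup>2) / 2) * (x * (p + r) / 2)
            - P * r * ((p + r) / 2 - x\<^sup>2 * (p\<^sup>2 + r\<^sup>2))
          = (x\<^sup>2 * (5 * P * r ^ 3 - 2 * r\<^sup>2 + p * r) - 2 * (P * r\<^sup>2 + r)) / 4"
          using pr by algebra
        also have "\<dots> = (x\<^sup>2 * (5 * P\<^sup>2 - 2 * P * R + R\<^sup>2) - 2 * P * R * (P + R)) * (p * r ^ 3) / 4"
          using pr by algebra
        finally show ?thesis
          by (simp add: m r'_def m'_def p_def r_def power_divide)
      qed
      moreover have "x\<^sup>2 * (5 * P\<^sup>2 - 2 * P * R + R\<^sup>2) - 2 * P * R * (P + R)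
        = (6 * d + 4) * R\<^sup>2 + (11 * d\<^sup>2 + 8 * d) * R + 5 * d ^ 3 + 5 * d\<^sup>2"
        unfolding xd unfolding Pd by (simp add: algebra_simps power2_eq_square power3_eq_cube)
      ultimately show ?thesis by simp
    qed
    have c2: "(2 * m * (P / R) + r') * m + 2 * (P / R) * m' + 2 * G = 0"
      unfolding Geq by (simp add: algebra_simps)
    have c3: "(P / R) * (c\<^sup>2 * R / P) = c\<^sup>2" using P R by simp
    \<comment> \<open>Up to the factor 2 / h the left side is y'' + (c^2 + G) y in tau. Sorted by f'
      and f, it vanishes because the transformed equation has no first-order term
      (\<open>c1\<close>), because G = - h'' / h (\<open>c2\<close>), and because the coefficient of
      f in the equation becomes the constant c^2 (\<open>c3\<close>).\<close>
    have "(2 * m * (P / R) + r') * u + 2 * (P / R) * u' + 2 * (c\<^sup>2 + G) * f x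
      = f' x * (2 * m * (P / R) + r' + 2 * (P / R) * m - 2 * (P / R) * (2 * x / P))
        + f x * ((2 * m * (P / R) + r') * m + 2 * (P / R) * m' + 2 * G)
        + 2 * f x * (c\<^sup>2 - (P / R) * (c\<^sup>2 * R / P))"
    proof -
      define \<rho> where "\<rho> = P / R"
      define \<sigma> where "\<sigma> = 2 * x / P"
      define \<tau> where "\<tau> = c\<^sup>2 * R / P"
      show ?thesis
        unfolding u_def u'_def f'' unfolding \<rho>_def[symmetric] \<sigma>_def[symmetric] \<tau>_def[symmetric]
        by (simp add: algebra_simps)
    qed
    also have "\<dots> = 0" unfolding c1 c2 c3 by simp
    finally have z: "(2 * m * (P / R) + r') * u + 2 * (P / R) * u' + 2 * (c\<^sup>2 + G) * f x = 0" .
    have "2 * m * B + B' = u * ((2 * m * (P / R) + r') * u + 2 * (P / R) * u' + 2 * (c\<^sup>2 + G) * f x)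
        + G' * (f x)\<^sup>2"
    proof -
      define \<rho> where "\<rho> = P / R"
      show ?thesis unfolding B_def B'_def \<rho>_def[symmetric]
        by (simp add: u_def power2_eq_square algebra_simps)
    qed
    then show ?thesis unfolding z by simp
  qed
  then have "sqrt (P * R) * (2 * m) * B + sqrt (P * R) * B' = sqrt (P * R) * (G' * (f x)\<^sup>2)"
    by (metis distrib_left mult.assoc)
  moreover have "sqrt (P * R) * (G' * (f x)\<^sup>2) \<le> 0"
    using G' P R by (intro mult_nonneg_nonpos mult_nonpos_nonneg) auto
  ultimately show ?thesis by metis
qed

lemma energy_antimono:
  assumes "x > 0" "x\<^sup>2 > turn" "x \<le> y"
  shows "energy y \<le> energy x"
proof (rule DERIV_nonpos_imp_nonincreasing[OF assms(3)])
  fix w assume w: "x \<le> w" "w \<le> y"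
  then have "x\<^sup>2 \<le> w\<^sup>2" using assms by (intro power_mono) auto
  then show "\<exists>k. (energy has_real_derivative k) (at w) \<and> k \<le> 0"
    using energy_deriv[of w] w assms by (metis less_le_trans)
qed

text \<open>Discarding the squared derivative and the nonnegative potential leaves c^2 h^2 f^2, and
  h^2 \<ge> x^2 - turn since turn > 1.\<close>

lemma energy_ge:
  assumes "x\<^sup>2 > turn"
  shows "c\<^sup>2 * (x\<^sup>2 - turn) * (f x)\<^sup>2 \<le> energy x"
proof -
  have P: "x\<^sup>2 - 1 \<ge> x\<^sup>2 - turn" using turn_gt_one by simp
  have "(x\<^sup>2 - turn)\<^sup>2 \<le> (x\<^sup>2 - 1) * (x\<^sup>2 - turn)"
    unfolding power2_eq_square[of "x\<^sup>2 - turn"] using P assms by (intro mult_right_mono) auto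
  then have "x\<^sup>2 - turn \<le> sqrt ((x\<^sup>2 - 1) * (x\<^sup>2 - turn))"
    by (rule real_le_rsqrt)
  moreover have "c\<^sup>2 * (f x)\<^sup>2 \<le> (x\<^sup>2 - 1) / (x\<^sup>2 - turn) * (amplitude_logder x * f x + f' x)\<^sup>2
      + (c\<^sup>2 + liouville_pot x) * (f x)\<^sup>2"
    using liouville_pot_nonneg[OF assms] assms P by (simp add: distrib_right)
  ultimately have "(x\<^sup>2 - turn) * (c\<^sup>2 * (f x)\<^sup>2) \<le> energy x"
    unfolding energy_def using assms P by (intro mult_mono) auto
  then show ?thesis by (simp add: mult_ac)
qed

text \<open>Along y the energy is at least (c y f)^2 times a factor tending to 1, and by
  monotonicity it stays below its value at the root x, where only the term in f'^2 survives.\<close>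

lemma derivative_at_root_ge_limit:
  assumes "x > 0" "x\<^sup>2 > turn" "f x = 0"
    and y: "filterlim y at_top sequentially" "(\<lambda>k. (c * y k * f (y k))\<^sup>2) \<longlonglongrightarrow> L"
  shows "L \<le> sqrt ((x\<^sup>2 - 1) * (x\<^sup>2 - turn)) * ((x\<^sup>2 - 1) / (x\<^sup>2 - turn)) * (f' x)\<^sup>2"
proof -
  have "(\<lambda>k. 1 - turn * inverse (y k) ^ 2) \<longlonglongrightarrow> 1 - turn * 0 ^ 2"
    by (intro tendsto_intros filterlim_compose[OF tendsto_inverse_0_at_top y(1)]
        tendsto_inverse_0_at_top y)
  then have "(\<lambda>k. (1 - turn * inverse (y k) ^ 2) * (c * y k * f (y k))\<^sup>2) \<longlonglongrightarrow> (1 - turn * 0 ^ 2) * L"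
    by (intro tendsto_mult y)
  then have lim: "(\<lambda>k. (1 - turn * inverse (y k) ^ 2) * (c * y k * f (y k))\<^sup>2) \<longlonglongrightarrow> L" by simp
  have "eventually (\<lambda>k. y k \<ge> x) sequentially"
    using y(1) by (simp add: filterlim_at_top)
  then have "eventually (\<lambda>k. (1 - turn * inverse (y k) ^ 2) * (c * y k * f (y k))\<^sup>2 \<le> energy x) sequentially"
  proof eventually_elim
    case (elim k)
    have "x\<^sup>2 \<le> (y k)\<^sup>2" using elim assms by (intro power_mono) auto
    then have "c\<^sup>2 * ((y k)\<^sup>2 - turn) * (f (y k))\<^sup>2 \<le> energy (y k)"
      using assms by (intro energy_ge) auto
    also have "\<dots> \<le> energy x" using assms elim by (intro energy_antimono) auto
    also have "c\<^sup>2 * ((y k)\<^sup>2 - turn) * (f (y k))\<^sup>2 = (1 - turn * inverse (y k) ^ 2) * (c * y k * f (y k))\<^sup>2"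
      using elim assms by (simp add: field_simps)
    finally show ?case .
  qed
  with lim have "L \<le> energy x"
    by (intro tendsto_upperbound) auto
  then show ?thesis using assms by (simp add: energy_def mult_ac)
qed

end

subsection \<open>Eigenfunctions of the cosine transform\<close>

lemma abs_cos_diff_le: "\<bar>cos u - cos v\<bar> \<le> \<bar>u - v\<bar>" for u v :: real
proof -
  have "\<bar>cos u - cos v\<bar> = 2 * (\<bar>sin ((u + v) / 2)\<bar> * \<bar>sin ((v - u) / 2)\<bar>)"
    by (simp add: cos_diff_cos abs_mult)
  also have "\<dots> \<le> 2 * (1 * \<bar>(v - u) / 2\<bar>)"
    by (intro mult_left_mono mult_mono abs_sin_x_le_abs_x) auto
  finally show ?thesis by simp
qed

text \<open>First step of a bootstrap: from square integrability of f alone, |f| \<le> 1 + f^2 is an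
  integrable bound that makes the transform Lipschitz. For an eigenfunction this gives the
  continuity required in \<open>cos_transform_deriv\<close>.\<close>

lemma cos_transform_continuous:
  fixes f g :: "real \<Rightarrow> real"
  assumes g: "\<And>x. ((\<lambda>t. f t * cos (c * x * t + \<phi>)) has_integral g x) {-1..1}"
    and sq: "(\<lambda>t. (f t)\<^sup>2) integrable_on {-1..1}"
  shows "continuous_on UNIV g"
proof -
  define M where "M = integral {-1..1} (\<lambda>t. 1 + (f t)\<^sup>2)"
  have int: "(\<lambda>t. 1 + (f t)\<^sup>2) integrable_on {-1..1}"
    by (intro integrable_add sq integrable_const_ivl)
  have "M \<ge> 0" unfolding M_def by (intro integral_nonneg int) simp
  have "\<bar>g x - g y\<bar> \<le> (\<bar>c\<bar> * M) * \<bar>x - y\<bar>" for x y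
  proof -
    have d: "((\<lambda>t. f t * cos (c * x * t + \<phi>) - f t * cos (c * y * t + \<phi>)) has_integral (g x - g y)) {-1..1}"
      by (intro has_integral_diff g)
    have "norm (integral {-1..1} (\<lambda>t. f t * cos (c * x * t + \<phi>) - f t * cos (c * y * t + \<phi>)))
      \<le> integral {-1..1} (\<lambda>t. (\<bar>c\<bar> * \<bar>x - y\<bar>) * (1 + (f t)\<^sup>2))"
    proof (rule integral_norm_bound_integral)
      show "(\<lambda>t. f t * cos (c * x * t + \<phi>) - f t * cos (c * y * t + \<phi>)) integrable_on {-1..1}"
        using d by blast
      show "(\<lambda>t. (\<bar>c\<bar> * \<bar>x - y\<bar>) * (1 + (f t)\<^sup>2)) integrable_on {-1..1}"
        by (intro integrable_on_mult_right int)
      fix t :: real assume t: "t \<in> {-1..1}"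
      have "\<bar>cos (c * x * t + \<phi>) - cos (c * y * t + \<phi>)\<bar> \<le> \<bar>(c * x * t + \<phi>) - (c * y * t + \<phi>)\<bar>"
        by (rule abs_cos_diff_le)
      also have "\<dots> = \<bar>c\<bar> * \<bar>x - y\<bar> * \<bar>t\<bar>"
        by (simp flip: abs_mult add: algebra_simps)
      also have "\<dots> \<le> \<bar>c\<bar> * \<bar>x - y\<bar>"
        using t by (intro mult_left_le) auto
      finally have "\<bar>f t\<bar> * \<bar>cos (c * x * t + \<phi>) - cos (c * y * t + \<phi>)\<bar> \<le> \<bar>f t\<bar> * (\<bar>c\<bar> * \<bar>x - y\<bar>)"
        by (intro mult_left_mono) auto
      also have "\<dots> \<le> (1 + (f t)\<^sup>2) * (\<bar>c\<bar> * \<bar>x - y\<bar>)"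
      proof (intro mult_right_mono)
        have "0 \<le> (\<bar>f t\<bar> - 1 / 2)\<^sup>2" by simp
        then show "\<bar>f t\<bar> \<le> 1 + (f t)\<^sup>2" by (simp add: power2_eq_square algebra_simps)
      qed auto
      finally show "norm (f t * cos (c * x * t + \<phi>) - f t * cos (c * y * t + \<phi>))
          \<le> (\<bar>c\<bar> * \<bar>x - y\<bar>) * (1 + (f t)\<^sup>2)"
        by (simp add: mult.commute flip: abs_mult right_diff_distrib)
    qed
    then show ?thesis using integral_unique[OF d] by (simp add: M_def mult_ac)
  qed
  then have "(\<bar>c\<bar> * M)-lipschitz_on UNIV g"
    using \<open>M \<ge> 0\<close> by (intro lipschitz_onI) (auto simp: dist_real_def)
  then show ?thesis by (rule lipschitz_on_continuous_on)
qed

text \<open>Keeping a free phase makes the derivative a transform of the same shape, with f replaced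
  by c t f and the phase advanced by pi/2, so the rule can be iterated.\<close>

lemma cos_transform_deriv:
  fixes f :: "real \<Rightarrow> real"
  assumes f: "continuous_on {-1..1} f"
  shows "((\<lambda>x. integral {-1..1} (\<lambda>t. f t * cos (c * x * t + \<phi>))) has_real_derivative
           integral {-1..1} (\<lambda>t. (c * t * f t) * cos (c * x * t + (\<phi> + pi / 2)))) (at x)"
proof -
  have f_snd: "continuous_on (UNIV \<times> {-1..1}) (\<lambda>p :: real \<times> real. f (snd p))"
    by (rule continuous_on_compose2[OF f]) (auto intro!: continuous_intros)
  have "((\<lambda>x. integral (cbox (-1) 1) (\<lambda>t. f t * cos (c * x * t + \<phi>))) has_real_derivative
           integral (cbox (-1) 1) (\<lambda>t. (c * t * f t) * cos (c * x * t + (\<phi> + pi / 2)))) (at x within UNIV)"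
  proof (rule leibniz_rule_field_derivative)
    show "((\<lambda>x. f t * cos (c * x * t + \<phi>)) has_real_derivative
        (c * t * f t) * cos (c * x * t + (\<phi> + pi / 2))) (at x within UNIV)" for x t
    proof -
      have "cos (c * x * t + (\<phi> + pi / 2)) = - sin (c * x * t + \<phi>)"
        using cos_add[of "c * x * t + \<phi>" "pi / 2"] by (simp add: add.assoc)
      then show ?thesis by (auto intro!: derivative_eq_intros)
    qed
    show "(\<lambda>t. f t * cos (c * x * t + \<phi>)) integrable_on cbox (-1) 1" for x
      using f by (intro integrable_continuous) (auto intro!: continuous_intros)
    show "continuous_on (UNIV \<times> cbox (-1) 1) (\<lambda>(x, t). (c * t * f t) * cos (c * x * t + (\<phi> + pi / 2)))"
      unfolding split_beta using f_snd by (auto intro!: continuous_intros)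
  qed auto
  then show ?thesis by simp
qed

text \<open>The phase treats even and odd eigenfunctions together: \<open>cos (2 * \<phi>)\<close>
  is the sign 1 or -1 of the parity.\<close>

locale cos_eigenfunction =
  fixes c \<mu> \<phi> :: real and f :: "real \<Rightarrow> real"
  assumes c_pos: "c > 0" and mu_nonzero: "\<mu> \<noteq> 0"
    and eigen: "\<And>x. ((\<lambda>t. f t * cos (c * x * t + \<phi>)) has_integral \<mu> * f x) {-1..1}"
    and unit_norm: "((\<lambda>t. (f t)\<^sup>2) has_integral 1) {-1..1}"
    and parity: "\<And>x. f (- x) = cos (2 * \<phi>) * f x" "(cos (2 * \<phi>))\<^sup>2 = 1"
begin

lemma continuous: "continuous_on A f"
proof -
  have "continuous_on UNIV (\<lambda>x. \<mu> * f x)"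
    using unit_norm by (intro cos_transform_continuous[OF eigen]) auto
  then have "continuous_on UNIV (\<lambda>x. (\<mu> * f x) / \<mu>)"
    by (rule continuous_on_divide[OF _ continuous_on_const]) (simp add: mu_nonzero)
  then have "continuous_on UNIV f" using mu_nonzero by simp
  then show ?thesis using continuous_on_subset by blast
qed

lemma f_eq: "f x = integral {-1..1} (\<lambda>t. f t * cos (c * x * t + \<phi>)) / \<mu>"
  using integral_unique[OF eigen[of x]] mu_nonzero by simp

lemma deriv_eq: "(f has_real_derivative deriv f x) (at x)"
  and deriv2_eq: "(deriv f has_real_derivative deriv (deriv f) x) (at x)"
  and deriv2_continuous: "continuous_on UNIV (deriv (deriv f))"
proof -
  define g where "g = (\<lambda>x. integral {-1..1} (\<lambda>t. (c * t * f t) * cos (c * x * t + (\<phi> + pi / 2))) / \<mu>)"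
  define h where "h = (\<lambda>x. integral {-1..1} (\<lambda>t. (c * t * (c * t * f t)) * cos (c * x * t + (\<phi> + pi / 2 + pi / 2))) / \<mu>)"
  note [continuous_intros] = continuous
  have f: "(f has_real_derivative g x) (at x)" for x
    unfolding g_def by (subst f_eq[abs_def]) (intro DERIV_cdivide cos_transform_deriv continuous)
  have g: "(g has_real_derivative h x) (at x)" for x
    unfolding g_def h_def by (intro DERIV_cdivide cos_transform_deriv continuous_intros)
  \<comment> \<open>A third differentiation yields the continuity of the second derivative.\<close>
  have "(h has_real_derivative integral {-1..1} (\<lambda>t. (c * t * (c * t * (c * t * f t)))
      * cos (c * x * t + (\<phi> + pi / 2 + pi / 2 + pi / 2))) / \<mu>) (at x)" for x
    unfolding h_def by (intro DERIV_cdivide cos_transform_deriv continuous_intros)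
  then have h: "continuous_on UNIV h"
    by (meson DERIV_continuous continuous_at_imp_continuous_on)
  have fg: "deriv f = g" using f DERIV_imp_deriv by blast
  moreover have gh: "deriv g = h" using g DERIV_imp_deriv by blast
  ultimately show "(f has_real_derivative deriv f x) (at x)"
    "(deriv f has_real_derivative deriv (deriv f) x) (at x)"
    "continuous_on UNIV (deriv (deriv f))"
    using f g h by auto
qed

text \<open>Two integrations by parts in the eigenvalue equation at w / c give w^2 mu f(w / c) = 2 w
  f(1) + O(1) for suitable frequencies w. Dividing by w and letting w grow yields the limit.\<close>

lemma value_at_one_limit:
  "\<exists>y. filterlim y at_top sequentially \<and> (\<lambda>k. (c * y k * f (y k))\<^sup>2) \<longlonglongrightarrow> 4 * (f 1)\<^sup>2 / \<mu>\<^sup>2"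
proof -
  \<comment> \<open>These frequencies make w + phi equal to pi/2 modulo 2 pi, so at t = 1 the sine
    is 1 and the cosine vanishes.\<close>
  define \<omega> where "\<omega> = (\<lambda>k::nat. pi / 2 - \<phi> + 2 * pi * real k)"
  have \<omega>_top: "filterlim \<omega> at_top sequentially"
    unfolding \<omega>_def
    by (intro filterlim_tendsto_add_at_top[OF tendsto_const]
        filterlim_tendsto_pos_mult_at_top[OF tendsto_const] filterlim_real_sequentially) simp
  define y where "y = (\<lambda>k. \<omega> k / c)"
  have y_top: "filterlim y at_top sequentially"
    unfolding y_def divide_inverse using c_pos
    by (intro filterlim_at_top_mult_tendsto_pos[OF tendsto_const] \<omega>_top) simp
  define B where "B = integral {-1..1} (\<lambda>t. \<bar>deriv (deriv f) t\<bar>)"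
  define C where "C = B + \<bar>deriv f (-1)\<bar>"
  have bound: "\<bar>\<mu> * (\<omega> k * f (y k)) - 2 * f 1\<bar> \<le> C / \<omega> k" if pos: "\<omega> k > 0" for k
  proof -
    define w where "w = \<omega> k"
    have w: "w > 0" using pos by (simp add: w_def)
    define J where "J = integral {-1..1} (\<lambda>t. deriv (deriv f) t * cos (w * t + \<phi>))"
    have cont: "continuous_on {-1..1} (\<lambda>t. deriv (deriv f) t * cos (w * t + \<phi>))"
      using deriv2_continuous continuous_on_subset by (auto intro!: continuous_intros)
    have abs_cont: "continuous_on {-1..1} (\<lambda>t. \<bar>deriv (deriv f) t\<bar>)"
      using deriv2_continuous continuous_on_subset by (auto intro!: continuous_intros)
    have J: "((\<lambda>t. deriv (deriv f) t * cos (w * t + \<phi>)) has_integral J) {-1..1}"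
      unfolding J_def by (intro integrable_integral integrable_continuous_interval cont)
    have J_le: "\<bar>J\<bar> \<le> B"
      unfolding J_def B_def real_norm_def[symmetric]
    proof (rule integral_norm_bound_integral)
      show "norm (deriv (deriv f) t * cos (w * t + \<phi>)) \<le> norm (deriv (deriv f) t)" for t
        by (simp add: abs_mult mult_left_le)
    qed (use cont abs_cont in \<open>auto intro!: integrable_continuous_interval\<close>)
    \<comment> \<open>\<open>F\<close> collects the boundary terms of both integrations by parts; in
      its derivative the two terms with f' times the sine cancel.\<close>
    define F where "F = (\<lambda>t. w * (f t * sin (w * t + \<phi>)) + deriv f t * cos (w * t + \<phi>))"
    have "((\<lambda>t. w\<^sup>2 * (f t * cos (w * t + \<phi>)) + deriv (deriv f) t * cos (w * t + \<phi>))
        has_integral F 1 - F (-1)) {-1..1}"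
      unfolding F_def
      by (intro fundamental_theorem_of_calculus)
        (auto intro!: derivative_eq_intros deriv_eq[THEN DERIV_subset] deriv2_eq[THEN DERIV_subset]
          simp: has_real_derivative_iff_has_vector_derivative[symmetric] algebra_simps power2_eq_square)
    moreover have "((\<lambda>t. w\<^sup>2 * (f t * cos (w * t + \<phi>)) + deriv (deriv f) t * cos (w * t + \<phi>))
        has_integral w\<^sup>2 * (\<mu> * f (y k)) + J) {-1..1}"
    proof -
      have "c * y k = w" using c_pos by (simp add: y_def w_def)
      then show ?thesis using eigen[of "y k"] J by (intro has_integral_add has_integral_mult_right) auto
    qed
    ultimately have eq: "w\<^sup>2 * (\<mu> * f (y k)) + J = F 1 - F (-1)"
      by (rule has_integral_unique[OF _ _, THEN sym])
    have per: "sin (w * 1 + \<phi>) = 1" "cos (w * 1 + \<phi>) = 0"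
    proof -
      have "w * 1 + \<phi> = pi / 2 + 2 * real k * pi" by (simp add: w_def \<omega>_def)
      then show "sin (w * 1 + \<phi>) = 1" "cos (w * 1 + \<phi>) = 0"
        by (simp_all only: sin_add cos_add sin_2npi cos_2npi) simp_all
    qed
    have per': "sin (w * (-1) + \<phi>) = - cos (2 * \<phi>)"
    proof -
      have "w * (-1) + \<phi> = (2 * \<phi> - pi / 2) - 2 * real k * pi" by (simp add: w_def \<omega>_def)
      then show ?thesis by (simp only: sin_diff sin_2npi cos_2npi) (simp add: sin_diff)
    qed
    \<comment> \<open>The sine at -1 and the parity of f contribute the same sign, whose square is
      1, so the two end points reinforce each other to 2 f(1).\<close>
    have "F 1 - F (-1) = w * (2 * f 1) - deriv f (-1) * cos (w * (-1) + \<phi>)"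
    proof -
      have "f (-1) * cos (2 * \<phi>) = (cos (2 * \<phi>))\<^sup>2 * f 1"
        using parity(1)[of 1] by (simp add: power2_eq_square)
      then show ?thesis unfolding F_def per per' using parity(2) by (simp add: algebra_simps)
    qed
    with eq have "w * (\<mu> * (w * f (y k)) - 2 * f 1) = - J - deriv f (-1) * cos (w * (-1) + \<phi>)"
      by (simp add: power2_eq_square algebra_simps)
    then have "w * \<bar>\<mu> * (w * f (y k)) - 2 * f 1\<bar> = \<bar>- J - deriv f (-1) * cos (w * (-1) + \<phi>)\<bar>"
      using w by (metis abs_mult abs_of_pos)
    also have "\<dots> \<le> \<bar>J\<bar> + \<bar>deriv f (-1) * cos (w * (-1) + \<phi>)\<bar>" by linarith
    also have "\<bar>deriv f (-1) * cos (w * (-1) + \<phi>)\<bar> \<le> \<bar>deriv f (-1)\<bar>"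
      unfolding abs_mult by (intro mult_left_le) auto
    also have "\<bar>J\<bar> + \<bar>deriv f (-1)\<bar> \<le> C" unfolding C_def using J_le by simp
    finally show ?thesis using w unfolding w_def by (simp add: field_simps)
  qed
  have "(\<lambda>k. \<mu> * (\<omega> k * f (y k)) - 2 * f 1) \<longlonglongrightarrow> 0"
  proof (rule tendsto_rabs_zero_cancel, rule tendsto_sandwich[OF _ _ tendsto_const])
    show "\<forall>\<^sub>F k in sequentially. \<bar>\<mu> * (\<omega> k * f (y k)) - 2 * f 1\<bar> \<le> C / \<omega> k"
      using filterlim_at_top_dense[THEN iffD1, OF \<omega>_top, rule_format, of 0]
      by eventually_elim (rule bound)
    show "(\<lambda>k. C / \<omega> k) \<longlonglongrightarrow> 0"
      by (rule real_tendsto_divide_at_top[OF tendsto_const \<omega>_top])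
  qed auto
  then have "(\<lambda>k. ((\<mu> * (\<omega> k * f (y k)) - 2 * f 1 + 2 * f 1) / \<mu>)\<^sup>2) \<longlonglongrightarrow> ((0 + 2 * f 1) / \<mu>)\<^sup>2"
    by (intro tendsto_intros) (auto simp: mu_nonzero)
  moreover have "(\<mu> * (\<omega> k * f (y k)) - 2 * f 1 + 2 * f 1) / \<mu> = c * y k * f (y k)" for k
    using mu_nonzero c_pos by (simp add: y_def)
  ultimately have "(\<lambda>k. (c * y k * f (y k))\<^sup>2) \<longlonglongrightarrow> 4 * (f 1)\<^sup>2 / \<mu>\<^sup>2"
    by (simp add: power_divide)
  then show ?thesis using y_top by blast
qed

end

text \<open>The even and odd parts of \<open>\<integral> \<psi> t e\<^sup>i\<^sup>c\<^sup>x\<^sup>t dt = \<lambda> \<psi> x\<close> are \<open>Re \<lambda> \<psi>\<close> and \<open>Im \<lambda> \<psi>\<close>, so one of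
  \<open>Re \<lambda>\<close>, \<open>Im \<lambda>\<close> vanishes. The phase is \<open>\<phi> = 0\<close> or \<open>\<phi> = - \<pi> / 2\<close> accordingly.\<close>

lemma pswf_cos_eigenfunction:
  assumes "pswf_system c lam psi chi"
  shows "\<exists>\<mu> \<phi>. \<bar>\<mu>\<bar> = norm (lam n) \<and> cos_eigenfunction c \<mu> \<phi> (psi n)"
proof -
  define a where "a = Re (lam n)"
  define b where "b = Im (lam n)"
  have c: "c > 0" and lam: "lam n \<noteq> 0"
    and E: "\<And>x. ((\<lambda>t. complex_of_real (psi n t) * exp (\<i> * complex_of_real (c * x * t)))
                has_integral (lam n * complex_of_real (psi n x))) {-1..1}"
    and unit: "((\<lambda>t. (psi n t)\<^sup>2) has_integral 1) {-1..1}"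
    using assms unfolding pswf_system_def by auto
  have C: "((\<lambda>t. psi n t * cos (c * x * t)) has_integral a * psi n x) {-1..1}" for x
    using has_integral_linear[OF E[of x] bounded_linear_Re]
    by (simp add: a_def o_def Re_exp)
  have S: "((\<lambda>t. psi n t * sin (c * x * t)) has_integral b * psi n x) {-1..1}" for x
    using has_integral_linear[OF E[of x] bounded_linear_Im]
    by (simp add: b_def o_def Im_exp)
  have even: "a * psi n (- x) = a * psi n x" for x
    using has_integral_unique[OF C[of "- x"]] C[of x] by simp
  have odd: "b * psi n (- x) = - (b * psi n x)" for x
  proof (rule has_integral_unique[OF S[of "- x"]])
    show "((\<lambda>t. psi n t * sin (c * - x * t)) has_integral - (b * psi n x)) {-1..1}"
      using has_integral_neg[OF S[of x]] by simp
  qed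
  \<comment> \<open>If both parts were nonzero, \<open>psi n\<close> would be even and odd at once,
    hence zero, against its unit norm.\<close>
  have "a = 0 \<or> b = 0"
  proof (rule ccontr)
    assume "\<not> ?thesis"
    then have "psi n (- x) = psi n x" "psi n (- x) = - psi n x" for x
      using even[of x] odd[of x] mult_left_cancel[of b "psi n (- x)" "- psi n x"] by auto
    then have "psi n x = 0" for x by (metis equal_neg_zero)
    then have "((\<lambda>t. (psi n t)\<^sup>2) has_integral 0) {-1..1}" by simp
    from has_integral_unique[OF unit this] show False by simp
  qed
  moreover have "a \<noteq> 0 \<or> b \<noteq> 0" using lam by (simp add: a_def b_def complex_eq_iff)
  ultimately consider "b = 0" "a \<noteq> 0" | "a = 0" "b \<noteq> 0" by blast
  then show ?thesis
  proof cases
    case 1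
    have "cos_eigenfunction c a 0 (psi n)"
    proof unfold_locales
      show "psi n (- x) = cos (2 * 0) * psi n x" for x using even[of x] 1 by simp
    qed (use c 1 C unit in auto)
    moreover have "\<bar>a\<bar> = norm (lam n)" using 1 by (simp add: a_def b_def cmod_eq_Re)
    ultimately show ?thesis by blast
  next
    case 2
    have "cos_eigenfunction c b (- (pi / 2)) (psi n)"
    proof unfold_locales
      show "((\<lambda>t. psi n t * cos (c * x * t + - (pi / 2))) has_integral b * psi n x) {-1..1}" for x
        using S[of x] by (simp add: cos_diff)
      show "psi n (- x) = cos (2 * - (pi / 2)) * psi n x" for x
        using odd[of x] 2 mult_left_cancel[of b "psi n (- x)" "- psi n x"] by simp
    qed (use c 2 unit in auto)
    moreover have "\<bar>b\<bar> = norm (lam n)" using 2 by (simp add: a_def b_def cmod_eq_Im)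
    ultimately show ?thesis by blast
  qed
qed

section \<open>Assembling the bound at the root\<close>

theorem theorem43:
  fixes c :: real and lam :: "nat \<Rightarrow> complex" and psi :: "nat \<Rightarrow> real \<Rightarrow> real"
    and chi :: "nat \<Rightarrow> real" and n :: nat and x :: real
  assumes "pswf_system c lam psi chi"
    and "chi n > c\<^sup>2"
    and "x > 1"
    and "psi n x = 0"
  shows "1 / \<bar>deriv (psi n) x\<bar>
           \<le> exp (1/4) * norm (lam n) * (x\<^sup>2 - 1) powr (3/4) / (x\<^sup>2 - chi n / c\<^sup>2) powr (1/4)"
proof -
  obtain \<mu> \<phi> where mu: "\<bar>\<mu>\<bar> = norm (lam n)" and "cos_eigenfunction c \<mu> \<phi> (psi n)"
    using pswf_cos_eigenfunction[OF assms(1)] by blast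
  then interpret cos_eigenfunction c \<mu> \<phi> "psi n" by simp
  interpret prolate_solution c "chi n" "psi n" "deriv (psi n)" "deriv (deriv (psi n))"
  proof unfold_locales
    show "(1 - x\<^sup>2) * deriv (deriv (psi n)) x - 2 * x * deriv (psi n) x
        + (chi n - c\<^sup>2 * x\<^sup>2) * psi n x = 0" for x
      using assms(1) unfolding pswf_system_def by blast
  qed (fact c_pos assms(2) deriv_eq deriv2_eq)+
  have "(psi n t)\<^sup>2 \<le> (psi n 1)\<^sup>2" if "t \<in> {-1..1}" for t
  proof (cases "t \<ge> 0")
    case True
    then show ?thesis using that by (intro square_le_value_at_one) auto
  next
    case False
    have "(psi n t)\<^sup>2 = (psi n (- t))\<^sup>2"
      using parity by (simp add: power_mult_distrib)
    also have "\<dots> \<le> (psi n 1)\<^sup>2" using that False by (intro square_le_value_at_one) auto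
    finally show ?thesis .
  qed
  \<comment> \<open>The unit mass is compared with the maximum of the square over an interval of
    length 2.\<close>
  then have "1 \<le> 2 * (psi n 1)\<^sup>2"
    using has_integral_le[OF unit_norm has_integral_const_real[of "(psi n 1)\<^sup>2" "-1" 1]] by simp
  then have one: "(psi n 1)\<^sup>2 \<ge> 1 / 2" by simp
  then have "psi n 1 \<noteq> 0" by auto
  with assms have turning: "x\<^sup>2 > turn"
    unfolding turn_def by (intro root_beyond_turning_point) auto
  obtain y where "filterlim y at_top sequentially"
    "(\<lambda>k. (c * y k * psi n (y k))\<^sup>2) \<longlonglongrightarrow> 4 * (psi n 1)\<^sup>2 / \<mu>\<^sup>2"
    using value_at_one_limit by blast
  then have lower: "4 * (psi n 1)\<^sup>2 / \<mu>\<^sup>2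
      \<le> sqrt ((x\<^sup>2 - 1) * (x\<^sup>2 - turn)) * ((x\<^sup>2 - 1) / (x\<^sup>2 - turn)) * (deriv (psi n) x)\<^sup>2"
    using assms turning by (intro derivative_at_root_ge_limit) auto
  define P where "P = x\<^sup>2 - 1"
  define R where "R = x\<^sup>2 - turn"
  have P: "P > 0" and R: "R > 0" using assms turning by (auto simp: P_def R_def)
  \<comment> \<open>\<open>T\<close> is chosen so that its square is the weight of the squared
    derivative in the energy at the root.\<close>
  define T where "T = P powr (3/4) / R powr (1/4)"
  have T: "T > 0" using P R by (simp add: T_def)
  have "T\<^sup>2 = (P * sqrt P) / sqrt R"
  proof -
    have "(P powr (3/4))\<^sup>2 = P powr (1 + 1/2)"
      by (simp add: power2_eq_square flip: powr_add)
    also have "\<dots> = P * sqrt P" using P by (simp only: powr_add) (simp add: powr_half_sqrt)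
    finally have "(P powr (3/4))\<^sup>2 = P * sqrt P" .
    moreover have "(R powr (1/4))\<^sup>2 = sqrt R"
      using R by (simp add: power2_eq_square powr_half_sqrt flip: powr_add)
    ultimately show ?thesis by (simp add: T_def power_divide)
  qed
  also have "\<dots> = sqrt (P * R) * (P / R)"
  proof -
    have "R = sqrt R * sqrt R" using R by simp
    then show ?thesis using R by (simp add: real_sqrt_mult field_simps)
  qed
  finally have "4 * (psi n 1)\<^sup>2 / \<mu>\<^sup>2 \<le> (T * deriv (psi n) x)\<^sup>2"
    using lower by (simp add: P_def R_def power_mult_distrib)
  \<comment> \<open>The value at 1 gives 4 * (1/2) = 2 in the numerator, of which only 1 is
    kept.\<close>
  moreover have "1 / \<mu>\<^sup>2 \<le> 4 * (psi n 1)\<^sup>2 / \<mu>\<^sup>2"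
    using one by (intro divide_right_mono) auto
  ultimately have "1 \<le> (\<mu> * (T * deriv (psi n) x))\<^sup>2"
    using mu_nonzero by (simp add: power_mult_distrib divide_le_eq mult_ac)
  then have "1 \<le> \<bar>\<mu> * (T * deriv (psi n) x)\<bar>"
    by (simp add: abs_le_square_iff[of 1, simplified])
  then have main: "1 \<le> \<bar>\<mu>\<bar> * T * \<bar>deriv (psi n) x\<bar>"
    using T by (simp add: abs_mult)
  \<comment> \<open>This rules out the default value 1 / 0 = 0, so the reciprocal in the claim is a
    genuine one.\<close>
  then have "deriv (psi n) x \<noteq> 0" by auto
  with main have "1 / \<bar>deriv (psi n) x\<bar> \<le> 1 * (\<bar>\<mu>\<bar> * T)"
    by (simp add: divide_le_eq)
  \<comment> \<open>The constant enters only through exp (1/4) \<ge> 1.\<close>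
  also have "\<dots> \<le> exp (1/4) * (\<bar>\<mu>\<bar> * T)"
    using T by (intro mult_right_mono) auto
  finally show ?thesis
    by (simp add: mu T_def P_def R_def turn_def)
qed

end
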